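(* Let $(\mathcal{B},[\cdot,\cdot,\cdot]_{\mathcal{B}},\rho)$ be a 3-$\rho$-Lie algebra, let $(V,\mu)$ be a $\rho$-skew-symmetric representation of $\mathcal{B}$, and let $T:V\to\mathcal{B}$ be a $\rho$-$\mathcal{O}$-operator associated to $(V,\mu)$. Define a new multiplication on $V$ by $\{x,y,z\}_V=\mu(Tx,Ty)z$ for all $x,y,z\in V$. Then $(V,\{\cdot,\cdot,\cdot\}_V,\rho)$ is a 3-pre-$\rho$-Lie algebra.
   Context: $\mathbb{K}=\mathbb{R}$ or $\mathbb{C}$; $(G,+)$ is an abelian group. A two-cycle is a map $\rho:G\times G\to\mathbb{K}^{*}$ with $\rho(a,b)=\rho(b,a)^{-1}$ and $\rho(a+b,c)=\rho(a,c)\rho(b,c)$. For homogeneous elements $f,g$ of $G$-graded spaces, $|f|$ is the degree, $\rho(f,g):=\rho(|f|,|g|)$, $\rho(f+g,h):=\rho(|f|+|g|,|h|)$, etc. Identities involving $\rho$ are required for all homogeneous elements. "Even" means of degree $0$. A 3-$\rho$-Lie algebra is a $G$-graded vector space $\mathcal{B}$ with a two-cycle $\rho$ and a trilinear map $[\cdot,\cdot,\cdot]_{\mathcal{B}}$ such that $|[f_1,f_2,f_3]|=|f_1|+|f_2|+|f_3|$; $[f_1,f_2,f_3]=-\rho(f_1,f_2)[f_2,f_1,f_3]=-\rho(f_2,f_3)[f_1,f_3,f_2]$; and $[f_1,f_2,[g_1,g_2,g_3]]=[[f_1,f_2,g_1],g_2,g_3]+\rho(f_1+f_2,g_1)[g_1,[f_1,f_2,g_2],g_3]+\rho(f_1+f_2,g_1+g_2)[g_1,g_2,[f_1,f_2,g_3]]$.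 A representation $(V,\mu)$ of $\mathcal{B}$ is a $G$-graded vector space $V$ with a bilinear map $\mu$ sending $(f,g)\in\mathcal{B}\times\mathcal{B}$ to $\mu(f,g)\in\mathrm{gl}(V)$, compatible with degrees ($|\mu(f,g)v|=|f|+|g|+|v|$), such that (R1) $\mu([f_1,f_2,g_1],g_2)+\rho(f_1+f_2,g_1)\mu(g_1,[f_1,f_2,g_2])=\mu(f_1,f_2)\mu(g_1,g_2)-\rho(f_1+f_2,g_1+g_2)\mu(g_1,g_2)\mu(f_1,f_2)$; (R2) $\mu([g_1,g_2,g_3],f)=\mu(g_1,g_2)\mu(g_3,f)+\rho(g_1,g_2+g_3)\mu(g_2,g_3)\mu(g_1,f)+\rho(g_1+g_2,g_3)\mu(g_3,g_1)\mu(g_2,f)$; (R3) $\mu(g,[f_1,f_2,f_3])=\rho(g,f_1+f_2)\mu(f_1,f_2)\mu(g,f_3)+\rho(g,f_2+f_3)\rho(f_1,f_2+f_3)\mu(f_2,f_3)\mu(g,f_1)+\rho(g,f_1+f_3)\rho(f_1+f_2,f_3)\mu(f_3,f_1)\mu(g,f_2)$. It is $\rho$-skew-symmetric if $\mu(f,g)=-\rho(f,g)\mu(g,f)$. A $\rho$-$\mathcal{O}$-operator associated to $(V,\mu)$ is an even linear map $T:V\to\mathcal{B}$ with $[Tx,Ty,Tz]_{\mathcal{B}}=T\big(\mu(Tx,Ty)z+\rho(x,y+z)\mu(Ty,Tz)x+\rho(x+y,z)\mu(Tz,Tx)y\big)$. A 3-pre-$\rho$-Lie algebra is a $G$-graded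 space $\mathcal{A}$ with a two-cycle $\rho$ and a trilinear map $\{\cdot,\cdot,\cdot\}$ such that $|\{f_1,f_2,f_3\}|=|f_1|+|f_2|+|f_3|$; $\{f_1,f_2,f_3\}=-\rho(f_1,f_2)\{f_2,f_1,f_3\}$; and, with $[f_1,f_2,f_3]_c:=\{f_1,f_2,f_3\}+\rho(f_1,f_2+f_3)\{f_2,f_3,f_1\}+\rho(f_1+f_2,f_3)\{f_3,f_1,f_2\}$, $\{f_1,f_2,\{g_1,g_2,g_3\}\}=\{[f_1,f_2,g_1]_c,g_2,g_3\}+\rho(f_1+f_2,g_1)\{g_1,[f_1,f_2,g_2]_c,g_3\}+\rho(f_1+f_2,g_1+g_2)\{g_1,g_2,\{f_1,f_2,g_3\}\}$, $\{[f_1,f_2,f_3]_c,g_1,g_2\}=\{f_1,f_2,\{f_3,g_1,g_2\}\}+\rho(f_1,f_2+f_3)\{f_2,f_3,\{f_1,g_1,g_2\}\}+\rho(f_1+f_2,f_3)\{f_3,f_1,\{f_2,g_1,g_2\}\}$. *)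

theory Defs
  imports Complex_Main
begin

text \<open>
  The ground field is \<open>\<real>\<close> or \<open>\<complex>\<close>, up to isomorphism of fields; only the algebraic structure
  is used.
\<close>

class real_or_complex = field +
  assumes real_or_complex:
    "(\<exists>\<phi> :: 'a \<Rightarrow> real. bij \<phi> \<and> \<phi> 1 = 1 \<and>
       (\<forall>x y. \<phi> (x + y) = \<phi> x + \<phi> y) \<and> (\<forall>x y. \<phi> (x * y) = \<phi> x * \<phi> y)) \<or>
     (\<exists>\<phi> :: 'a \<Rightarrow> complex. bij \<phi> \<and> \<phi> 1 = 1 \<and>
       (\<forall>x y. \<phi> (x + y) = \<phi> x + \<phi> y) \<and> (\<forall>x y. \<phi> (x * y) = \<phi> x * \<phi> y))"

instance real :: real_or_complex
  by standard (rule disjI1, rule exI[of _ id], simp)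

instance complex :: real_or_complex
  by standard (rule disjI2, rule exI[of _ id], simp)

locale two_cycle =
  fixes \<rho> :: "'g::ab_group_add \<Rightarrow> 'g \<Rightarrow> 'k::real_or_complex"
  assumes nonzero: "\<rho> a b \<noteq> 0"
    and swap: "\<rho> a b = inverse (\<rho> b a)"
    and add_left: "\<rho> (a + b) c = \<rho> a c * \<rho> b c"

text \<open>
  The space is the internal direct sum of the subspaces \<open>V a\<close>: every vector has a unique
  decomposition into finitely many nonzero homogeneous components.
\<close>

locale graded_vector_space = vector_space scale
  for scale :: "'k::real_or_complex \<Rightarrow> 'v::ab_group_add \<Rightarrow> 'v" +
  fixes V :: "'g::ab_group_add \<Rightarrow> 'v set"
  assumes component_subspace: "module.subspace scale (V a)"
    and direct_sum:
      "\<exists>!d :: 'g \<Rightarrow> 'v. (\<forall>a. d a \<in> V a) \<and> finite {a. d a \<noteq> 0} \<and> v = (\<Sum>a | d a \<noteq> 0. d a)"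

definition trilinear ::
  "('k::field \<Rightarrow> 'v::ab_group_add \<Rightarrow> 'v) \<Rightarrow> ('v \<Rightarrow> 'v \<Rightarrow> 'v \<Rightarrow> 'v) \<Rightarrow> bool" where
  "trilinear scale m \<longleftrightarrow>
     (\<forall>y z. Vector_Spaces.linear scale scale (\<lambda>x. m x y z)) \<and>
     (\<forall>x z. Vector_Spaces.linear scale scale (\<lambda>y. m x y z)) \<and>
     (\<forall>x y. Vector_Spaces.linear scale scale (\<lambda>z. m x y z))"

text \<open>
  In all identities below the degree of a homogeneous element \<open>f\<close> is a separate variable \<open>a\<close>
  with \<open>f \<in> V a\<close>. The zero vector, which has no well-defined degree, thus counts as homogeneous
  of every degree; by multilinearity this imposes no extra condition.
\<close>

locale three_rho_Lie_algebra =
  graded_vector_space scale B + two_cycle \<rho>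
  for scale :: "'k::real_or_complex \<Rightarrow> 'b::ab_group_add \<Rightarrow> 'b"
    and B :: "'g::ab_group_add \<Rightarrow> 'b set"
    and \<rho> :: "'g \<Rightarrow> 'g \<Rightarrow> 'k" +
  fixes br :: "'b \<Rightarrow> 'b \<Rightarrow> 'b \<Rightarrow> 'b"
  assumes br_trilinear: "trilinear scale br"
    and br_degree:
      "\<lbrakk>f1 \<in> B a1; f2 \<in> B a2; f3 \<in> B a3\<rbrakk> \<Longrightarrow> br f1 f2 f3 \<in> B (a1 + a2 + a3)"
    and br_skew12:
      "\<lbrakk>f1 \<in> B a1; f2 \<in> B a2; f3 \<in> B a3\<rbrakk> \<Longrightarrow>
        br f1 f2 f3 = - scale (\<rho> a1 a2) (br f2 f1 f3)"
    and br_skew23: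
      "\<lbrakk>f1 \<in> B a1; f2 \<in> B a2; f3 \<in> B a3\<rbrakk> \<Longrightarrow>
        br f1 f2 f3 = - scale (\<rho> a2 a3) (br f1 f3 f2)"
    and br_fundamental:
      "\<lbrakk>f1 \<in> B a1; f2 \<in> B a2; g1 \<in> B b1; g2 \<in> B b2; g3 \<in> B b3\<rbrakk> \<Longrightarrow>
        br f1 f2 (br g1 g2 g3) =
          br (br f1 f2 g1) g2 g3
          + scale (\<rho> (a1 + a2) b1) (br g1 (br f1 f2 g2) g3)
          + scale (\<rho> (a1 + a2) (b1 + b2)) (br g1 g2 (br f1 f2 g3))"

text \<open>
  The operator \<open>\<mu>(f,g) \<in> gl(V)\<close> is the linear map \<open>\<mu> f g\<close>, so bilinearity of \<open>\<mu>\<close> and the identities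
  between operators are stated pointwise, with \<open>v\<close> ranging over all of the space.
\<close>

locale rho_representation =
  three_rho_Lie_algebra scaleB B \<rho> br + V: graded_vector_space scaleV V
  for scaleB :: "'k::real_or_complex \<Rightarrow> 'b::ab_group_add \<Rightarrow> 'b"
    and B :: "'g::ab_group_add \<Rightarrow> 'b set"
    and \<rho> :: "'g \<Rightarrow> 'g \<Rightarrow> 'k"
    and br :: "'b \<Rightarrow> 'b \<Rightarrow> 'b \<Rightarrow> 'b"
    and scaleV :: "'k \<Rightarrow> 'v::ab_group_add \<Rightarrow> 'v"
    and V :: "'g \<Rightarrow> 'v set" +
  fixes \<mu> :: "'b \<Rightarrow> 'b \<Rightarrow> 'v \<Rightarrow> 'v"
  assumes mu_endomorphism: "Vector_Spaces.linear scaleV scaleV (\<mu> f g)"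
    and mu_linear_left: "Vector_Spaces.linear scaleB scaleV (\<lambda>f. \<mu> f g v)"
    and mu_linear_right: "Vector_Spaces.linear scaleB scaleV (\<lambda>g. \<mu> f g v)"
    and mu_degree:
      "\<lbrakk>f \<in> B a; g \<in> B b; v \<in> V c\<rbrakk> \<Longrightarrow> \<mu> f g v \<in> V (a + b + c)"
    and R1:
      "\<lbrakk>f1 \<in> B a1; f2 \<in> B a2; g1 \<in> B b1; g2 \<in> B b2\<rbrakk> \<Longrightarrow>
        \<mu> (br f1 f2 g1) g2 v + scaleV (\<rho> (a1 + a2) b1) (\<mu> g1 (br f1 f2 g2) v) =
          \<mu> f1 f2 (\<mu> g1 g2 v) - scaleV (\<rho> (a1 + a2) (b1 + b2)) (\<mu> g1 g2 (\<mu> f1 f2 v))"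
    and R2:
      "\<lbrakk>g1 \<in> B b1; g2 \<in> B b2; g3 \<in> B b3; f \<in> B a\<rbrakk> \<Longrightarrow>
        \<mu> (br g1 g2 g3) f v =
          \<mu> g1 g2 (\<mu> g3 f v)
          + scaleV (\<rho> b1 (b2 + b3)) (\<mu> g2 g3 (\<mu> g1 f v))
          + scaleV (\<rho> (b1 + b2) b3) (\<mu> g3 g1 (\<mu> g2 f v))"
    and R3:
      "\<lbrakk>g \<in> B b; f1 \<in> B a1; f2 \<in> B a2; f3 \<in> B a3\<rbrakk> \<Longrightarrow>
        \<mu> g (br f1 f2 f3) v =
          scaleV (\<rho> b (a1 + a2)) (\<mu> f1 f2 (\<mu> g f3 v))
          + scaleV (\<rho> b (a2 + a3) * \<rho> a1 (a2 + a3)) (\<mu> f2 f3 (\<mu> g f1 v))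
          + scaleV (\<rho> b (a1 + a3) * \<rho> (a1 + a2) a3) (\<mu> f3 f1 (\<mu> g f2 v))"

locale rho_skew_symmetric_representation =
  rho_representation scaleB B \<rho> br scaleV V \<mu>
  for scaleB :: "'k::real_or_complex \<Rightarrow> 'b::ab_group_add \<Rightarrow> 'b"
    and B :: "'g::ab_group_add \<Rightarrow> 'b set"
    and \<rho> :: "'g \<Rightarrow> 'g \<Rightarrow> 'k"
    and br :: "'b \<Rightarrow> 'b \<Rightarrow> 'b \<Rightarrow> 'b"
    and scaleV :: "'k \<Rightarrow> 'v::ab_group_add \<Rightarrow> 'v"
    and V :: "'g \<Rightarrow> 'v set"
    and \<mu> :: "'b \<Rightarrow> 'b \<Rightarrow> 'v \<Rightarrow> 'v" +
  assumes mu_skew: "\<lbrakk>f \<in> B a; g \<in> B b\<rbrakk> \<Longrightarrow> \<mu> f g v = - scaleV (\<rho> a b) (\<mu> g f v)"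

locale rho_O_operator =
  rho_representation scaleB B \<rho> br scaleV V \<mu>
  for scaleB :: "'k::real_or_complex \<Rightarrow> 'b::ab_group_add \<Rightarrow> 'b"
    and B :: "'g::ab_group_add \<Rightarrow> 'b set"
    and \<rho> :: "'g \<Rightarrow> 'g \<Rightarrow> 'k"
    and br :: "'b \<Rightarrow> 'b \<Rightarrow> 'b \<Rightarrow> 'b"
    and scaleV :: "'k \<Rightarrow> 'v::ab_group_add \<Rightarrow> 'v"
    and V :: "'g \<Rightarrow> 'v set"
    and \<mu> :: "'b \<Rightarrow> 'b \<Rightarrow> 'v \<Rightarrow> 'v" +
  fixes T :: "'v \<Rightarrow> 'b"
  assumes T_linear: "Vector_Spaces.linear scaleV scaleB T"
    and T_even: "x \<in> V a \<Longrightarrow> T x \<in> B a"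
    and T_identity:
      "\<lbrakk>x \<in> V a; y \<in> V b; z \<in> V c\<rbrakk> \<Longrightarrow>
        br (T x) (T y) (T z) =
          T (\<mu> (T x) (T y) z
             + scaleV (\<rho> a (b + c)) (\<mu> (T y) (T z) x)
             + scaleV (\<rho> (a + b) c) (\<mu> (T z) (T x) y))"

text \<open>
  The bracket \<open>[f1, f2, f3]\<^sub>c\<close> of homogeneous elements, whose degrees \<open>a1\<close>, \<open>a2\<close>, \<open>a3\<close> are
  passed explicitly.
\<close>

definition c_bracket ::
  "('k \<Rightarrow> 'v::ab_group_add \<Rightarrow> 'v) \<Rightarrow> ('g::ab_group_add \<Rightarrow> 'g \<Rightarrow> 'k) \<Rightarrow> ('v \<Rightarrow> 'v \<Rightarrow> 'v \<Rightarrow> 'v) \<Rightarrow>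
    'g \<Rightarrow> 'g \<Rightarrow> 'g \<Rightarrow> 'v \<Rightarrow> 'v \<Rightarrow> 'v \<Rightarrow> 'v" where
  "c_bracket scale \<rho> m a1 a2 a3 f1 f2 f3 =
     m f1 f2 f3 + scale (\<rho> a1 (a2 + a3)) (m f2 f3 f1) + scale (\<rho> (a1 + a2) a3) (m f3 f1 f2)"

locale three_pre_rho_Lie_algebra =
  graded_vector_space scale A + two_cycle \<rho>
  for scale :: "'k::real_or_complex \<Rightarrow> 'v::ab_group_add \<Rightarrow> 'v"
    and A :: "'g::ab_group_add \<Rightarrow> 'v set"
    and \<rho> :: "'g \<Rightarrow> 'g \<Rightarrow> 'k" +
  fixes m :: "'v \<Rightarrow> 'v \<Rightarrow> 'v \<Rightarrow> 'v"
  assumes m_trilinear: "trilinear scale m"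
    and m_degree:
      "\<lbrakk>f1 \<in> A a1; f2 \<in> A a2; f3 \<in> A a3\<rbrakk> \<Longrightarrow> m f1 f2 f3 \<in> A (a1 + a2 + a3)"
    and m_skew:
      "\<lbrakk>f1 \<in> A a1; f2 \<in> A a2; f3 \<in> A a3\<rbrakk> \<Longrightarrow>
        m f1 f2 f3 = - scale (\<rho> a1 a2) (m f2 f1 f3)"
    and m_fundamental:
      "\<lbrakk>f1 \<in> A a1; f2 \<in> A a2; g1 \<in> A b1; g2 \<in> A b2; g3 \<in> A b3\<rbrakk> \<Longrightarrow>
        m f1 f2 (m g1 g2 g3) =
          m (c_bracket scale \<rho> m a1 a2 b1 f1 f2 g1) g2 g3
          + scale (\<rho> (a1 + a2) b1) (m g1 (c_bracket scale \<rho> m a1 a2 b2 f1 f2 g2) g3)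
          + scale (\<rho> (a1 + a2) (b1 + b2)) (m g1 g2 (m f1 f2 g3))"
    and m_c_bracket:
      "\<lbrakk>f1 \<in> A a1; f2 \<in> A a2; f3 \<in> A a3; g1 \<in> A b1; g2 \<in> A b2\<rbrakk> \<Longrightarrow>
        m (c_bracket scale \<rho> m a1 a2 a3 f1 f2 f3) g1 g2 =
          m f1 f2 (m f3 g1 g2)
          + scale (\<rho> a1 (a2 + a3)) (m f2 f3 (m f1 g1 g2))
          + scale (\<rho> (a1 + a2) a3) (m f3 f1 (m f2 g1 g2))"

end

theory Submission
  imports Defs
begin

text \<open>The \<open>\<rho>\<close>-\<open>\<O>\<close>-operator identity says that T carries the
  c-bracket of the new product to the bracket of the 3-\<open>\<rho>\<close>-Lie algebra: T[x,y,z]_c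
  = [Tx,Ty,Tz]. Hence an inner c-bracket in the first or second slot of the product becomes a
  bracket inside \<open>\<mu>\<close>, and the two 3-pre-\<open>\<rho>\<close>-Lie identities are R1
  and R2 evaluated at images under T. As T is even, degrees and all factors of \<open>\<rho>\<close>
  are unchanged, and skew-symmetry is inherited from \<open>\<mu>\<close>.\<close>

theorem lemma4p10:
  fixes scaleB :: "'k::real_or_complex \<Rightarrow> 'b::ab_group_add \<Rightarrow> 'b"
    and B :: "'g::ab_group_add \<Rightarrow> 'b set"
    and \<rho> :: "'g \<Rightarrow> 'g \<Rightarrow> 'k"
    and br :: "'b \<Rightarrow> 'b \<Rightarrow> 'b \<Rightarrow> 'b"
    and scaleV :: "'k \<Rightarrow> 'v::ab_group_add \<Rightarrow> 'v"
    and V :: "'g \<Rightarrow> 'v set"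
    and \<mu> :: "'b \<Rightarrow> 'b \<Rightarrow> 'v \<Rightarrow> 'v"
    and T :: "'v \<Rightarrow> 'b"
  assumes "three_rho_Lie_algebra scaleB B \<rho> br"
    and "rho_skew_symmetric_representation scaleB B \<rho> br scaleV V \<mu>"
    and "rho_O_operator scaleB B \<rho> br scaleV V \<mu> T"
  shows "three_pre_rho_Lie_algebra scaleV V \<rho> (\<lambda>x y z. \<mu> (T x) (T y) z)"
proof -
  interpret S: rho_skew_symmetric_representation scaleB B \<rho> br scaleV V \<mu>
    by fact
  interpret O: rho_O_operator scaleB B \<rho> br scaleV V \<mu> T
    by fact
  let ?m = "\<lambda>x y z. \<mu> (T x) (T y) z"
  have T_c: "T (c_bracket scaleV \<rho> ?m a b c x y z) = br (T x) (T y) (T z)"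
    if "x \<in> V a" "y \<in> V b" "z \<in> V c" for a b c x y z
    unfolding c_bracket_def by (rule O.T_identity[OF that, symmetric])
  show ?thesis
  \<comment> \<open>The grading of V and the two-cycle axioms come from the interpretations; only
    the axioms on the product remain.\<close>
  proof unfold_locales
    show "trilinear scaleV ?m"
      unfolding trilinear_def
      using Vector_Spaces.linear_compose[OF O.T_linear S.mu_linear_left]
        Vector_Spaces.linear_compose[OF O.T_linear S.mu_linear_right] S.mu_endomorphism
      by (simp add: o_def)
  next
    fix f1 f2 f3 a1 a2 a3
    assume "f1 \<in> V a1" "f2 \<in> V a2" "f3 \<in> V a3"
    then show "?m f1 f2 f3 \<in> V (a1 + a2 + a3)"
      and "?m f1 f2 f3 = - scaleV (\<rho> a1 a2) (?m f2 f1 f3)"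
      by (auto intro: S.mu_degree S.mu_skew O.T_even)
  next
    fix f1 f2 g1 g2 g3 a1 a2 b1 b2 b3
    assume h: "f1 \<in> V a1" "f2 \<in> V a2" "g1 \<in> V b1" "g2 \<in> V b2" "g3 \<in> V b3"
    show "?m f1 f2 (?m g1 g2 g3) =
        ?m (c_bracket scaleV \<rho> ?m a1 a2 b1 f1 f2 g1) g2 g3
        + scaleV (\<rho> (a1 + a2) b1) (?m g1 (c_bracket scaleV \<rho> ?m a1 a2 b2 f1 f2 g2) g3)
        + scaleV (\<rho> (a1 + a2) (b1 + b2)) (?m g1 g2 (?m f1 f2 g3))"
      \<comment> \<open>R1 is applied to the vector \<open>g3\<close>; moving its subtracted term
        across gives the claim.\<close>
      using S.R1[OF h(1-4)[THEN O.T_even], of g3] by (simp add: T_c h)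
  next
    fix f1 f2 f3 g1 g2 a1 a2 a3 b1 b2
    assume h: "f1 \<in> V a1" "f2 \<in> V a2" "f3 \<in> V a3" "g1 \<in> V b1" "g2 \<in> V b2"
    show "?m (c_bracket scaleV \<rho> ?m a1 a2 a3 f1 f2 f3) g1 g2 =
        ?m f1 f2 (?m f3 g1 g2)
        + scaleV (\<rho> a1 (a2 + a3)) (?m f2 f3 (?m f1 g1 g2))
        + scaleV (\<rho> (a1 + a2) a3) (?m f3 f1 (?m f2 g1 g2))"
      \<comment> \<open>In R2, \<open>T g1\<close> is the last argument f, and \<open>g2\<close> is
        the vector acted on.\<close>
      using S.R2[OF h(1-4)[THEN O.T_even], of g2] by (simp add: T_c h)
  qed
qed

end
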